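(* Let $k\ge 2$ be an integer and let $p_k(n)$ denote the number of partitions of $n$ in which no part is divisible by $k$ (the $k$-regular partition function). For integers $2\le a\le b$ consider the Bessenrodt--Ono inequality $$p_k(a)\,p_k(b) > p_k(a+b).$$ Let $E_k$ be the set of pairs $(a,b)$ with $2\le a\le b$ for which $p_k(a)p_k(b)=p_k(a+b)$, and $F_k$ the set of pairs $(a,b)$ with $2\le a\le b$ for which $p_k(a)p_k(b)<p_k(a+b)$. Then the Bessenrodt--Ono inequality holds for all pairs $(a,b)$ with $2\le a\le b$ except those in $E_k\cup F_k$, and these sets are as follows: \begin{itemize} \item $k=2$: $E_2=\{(3,3),(3,5),(3,6),(3,7),(3,8),(4,15),(4,16),(4,17),(5,6),(5,7),(5,8)\}$, and $F_2=\{(2,b): b\ge 2\}\cup\{(3,4),(4,4),(4,5),(4,6),(4,7),(4,8),(4,9),(4,10),(4,11),(4,12),(4,13),(4,14),(5,5)\}$; \item $k=3$: $E_3=\{(2,2),(3,10)\}$, $F_3=\{(2,3),(3,3),(3,4),(3,5),(3,6),(3,7),(3,8),(3,9),(3,11),(3,13)\}$; \item $k=4$: $E_4=\{(2,2),(2,3),(2,5),(3,3),(3,4),(4,4)\}$, $F_4=\{(2,4)\}$; \item $k=5$: $E_5=\{(2,3),(2,4)\}$, $F_5=\{(2,2),(2,5),(3,3),(3,5)\}$; \item $k=6$: $E_6=\{(2,4),(2,5),(2,6)\}$, $F_6=\{(2,2),(2,3),(3,3)\}$; \item $k=7$: $E_7=\{(2,5),(2,7),(3,5)\}$, $F_7=\{(2,2),(2,3),(2,4),(3,3)\}$;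 \item $k=8$: $E_8=\{(3,4),(3,5)\}$, $F_8=\{(2,2),(2,3),(2,4),(2,5),(3,3)\}$; \item $k=9$: $E_9=\{(2,6),(3,4)\}$, $F_9=\{(2,2),(2,3),(2,4),(2,5),(3,3),(3,5)\}$; \item for every $k\ge 10$: $E_k=\{(2,6),(2,7),(3,4)\}$ and $F_k=\{(2,2),(2,3),(2,4),(2,5),(3,3),(3,5)\}$, i.e. $E_k$ and $F_k$ coincide with the corresponding exception sets $E_\infty$, $F_\infty$ for the ordinary partition function $p(n)$. \end{itemize}
   Context: A partition of a positive integer $n$ is a finite nonincreasing sequence of positive integers summing to $n$; $p(n)$ is the number of partitions of $n$, with $p(0)=1$. For $k\ge2$, $p_k(n)$ is the number of partitions of $n$ with no part divisible by $k$ (equivalently, each part appearing at most $k-1$ times), $p_k(0)=1$; its generating function is $\prod_{n\ge1}(1-q^{kn})/(1-q^n)$. $E_\infty=\{(2,6),(2,7),(3,4)\}$ and $F_\infty=\{(2,2),(2,3),(2,4),(2,5),(3,3),(3,5)\}$ are the sets of pairs $2\le a\le b$ with $p(a)p(b)=p(a+b)$, resp. $p(a)p(b)<p(a+b)$. *)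

theory Defs
  imports Main
begin

definition partitions :: "nat \<Rightarrow> nat list set" where
  "partitions n = {xs. sorted_wrt (\<ge>) xs \<and> (\<forall>x\<in>set xs. x > 0) \<and> sum_list xs = n}"

definition regular_partitions :: "nat \<Rightarrow> nat \<Rightarrow> nat list set" where
  "regular_partitions k n = {xs \<in> partitions n. \<forall>x\<in>set xs. \<not> k dvd x}"

definition p_ord :: "nat \<Rightarrow> nat" where
  "p_ord n = card (partitions n)"

definition p_reg :: "nat \<Rightarrow> nat \<Rightarrow> nat" where
  "p_reg k n = card (regular_partitions k n)"

definition equality_pairs :: "(nat \<Rightarrow> nat) \<Rightarrow> (nat \<times> nat) set" where
  "equality_pairs f = {(a, b). 2 \<le> a \<and> a \<le> b \<and> f a * f b = f (a + b)}"

definition failure_pairs :: "(nat \<Rightarrow> nat) \<Rightarrow> (nat \<times> nat) set" where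
  "failure_pairs f = {(a, b). 2 \<le> a \<and> a \<le> b \<and> f a * f b < f (a + b)}"

definition E_reg :: "nat \<Rightarrow> (nat \<times> nat) set" where
  "E_reg k = equality_pairs (p_reg k)"

definition F_reg :: "nat \<Rightarrow> (nat \<times> nat) set" where
  "F_reg k = failure_pairs (p_reg k)"

definition E_inf :: "(nat \<times> nat) set" where
  "E_inf = equality_pairs p_ord"

definition F_inf :: "(nat \<times> nat) set" where
  "F_inf = failure_pairs p_ord"

(* Finiteness ensures that the cardinalities above are genuine counts. *)
lemma finite_partitions: "finite (partitions n)"
proof (rule finite_subset)
  have "length xs \<le> sum_list xs" if "\<forall>x\<in>set xs. x > 0" for xs :: "nat list"
    using that by (induction xs) auto
  then show "partitions n \<subseteq> {xs. set xs \<subseteq> {..n} \<and> length xs \<le> n}"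
    by (auto simp: partitions_def dest: member_le_sum_list)
  show "finite {xs. set xs \<subseteq> {..n} \<and> length xs \<le> n}"
    by (rule finite_lists_length_le) simp
qed

lemma partitions_0: "partitions 0 = {[]}"
proof -
  have "xs = []" if "\<forall>x\<in>set xs. x > 0" "sum_list xs = 0" for xs :: "nat list"
    using that by (cases xs) auto
  then show ?thesis by (auto simp: partitions_def)
qed

lemma p_ord_0: "p_ord 0 = 1"
  by (simp add: p_ord_def partitions_0)

lemma p_reg_0: "p_reg k 0 = 1"
proof -
  have "regular_partitions k 0 = {[]}"
    by (auto simp: regular_partitions_def partitions_0)
  then show ?thesis by (simp add: p_reg_def)
qed

end

theory Submission
  imports Defs "HOL-Library.Multiset" "HOL-Library.Code_Binary_Nat"
begin

text \<open>
  Write \<open>p\<close> for \<open>p_k\<close> and \<open>\<sigma>(l)\<close> for the sum of the divisors of \<open>l\<close> that are not divisible by \<open>k\<close>.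
  Counting the parts of all partitions of \<open>n\<close> gives \<open>n p(n) = \<Sum>\<^sub>l \<sigma>(l) p(n - l)\<close>. For \<open>a \<le> b\<close>
  expand \<open>(a + b) p(a + b)\<close> in this way. The terms with \<open>l \<le> b\<close> are at most \<open>\<sigma>(l) p(a) p(b - l)\<close> by
  induction and sum to \<open>b p(a) p(b)\<close>, apart from the exceptional pairs \<open>(a, b - l)\<close>, whose excess
  \<open>p(a + m) - p(a) p(m)\<close> is \<open>O(a p(a))\<close> in total. The \<open>a\<close> terms with \<open>l > b\<close> are at most
  \<open>\<sigma>(l) p(a)\<close>. Both errors carry a factor \<open>\<sigma>(l) = O(b\<^sup>2)\<close>, so they are absorbed by the
  remaining \<open>a p(a) p(b)\<close> once \<open>p(b)\<close> exceeds a fixed multiple of \<open>b\<^sup>2 + 5 b\<close>, that is, for all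
  \<open>b\<close> from some small bound \<open>B\<close> on. The pairs with \<open>b < B\<close> are settled by computation. Since
  \<open>p_k(n) = p(n)\<close> for \<open>n < k\<close>, the case \<open>k \<ge> 2 B\<close> needs only the table of the ordinary partition
  function, which is the case \<open>k = 0\<close> of \<open>p_k\<close>.
\<close>

section \<open>Counting partitions with parts in a set\<close>

text \<open>Multisets let parts be added and deleted without regard to order, and a general
  \<open>A\<close> allows single parts to be struck out.\<close>

definition parts_in :: "nat set \<Rightarrow> nat \<Rightarrow> nat multiset set" where
  "parts_in A n = {M. set_mset M \<subseteq> A \<and> sum_mset M = n}"

definition pcount :: "nat set \<Rightarrow> nat \<Rightarrow> nat" where
  "pcount A n = card (parts_in A n)"

lemma bij_betw_mset_partitions:
  assumes "0 \<notin> A"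
  shows "bij_betw mset {xs \<in> partitions n. set xs \<subseteq> A} (parts_in A n)"
proof (rule bij_betw_byWitness[where f' = "\<lambda>M. rev (sorted_list_of_multiset M)"])
  have "sorted (rev xs)" if "xs \<in> partitions n" for xs
    using that by (simp add: partitions_def sorted_wrt_rev)
  then show "\<forall>xs\<in>{xs \<in> partitions n. set xs \<subseteq> A}. rev (sorted_list_of_multiset (mset xs)) = xs"
    by (metis (no_types, lifting) mem_Collect_eq mset_rev rev_rev_ident sort_key_id_if_sorted
        sorted_list_of_multiset_mset sorted_sort_id)
  show "\<forall>M\<in>parts_in A n. mset (rev (sorted_list_of_multiset M)) = M"
    by simp
  show "mset ` {xs \<in> partitions n. set xs \<subseteq> A} \<subseteq> parts_in A n"
    by (auto simp: partitions_def parts_in_def sum_mset_sum_list)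
  show "(\<lambda>M. rev (sorted_list_of_multiset M)) ` parts_in A n \<subseteq> {xs \<in> partitions n. set xs \<subseteq> A}"
  proof (intro image_subsetI CollectI conjI)
    fix M assume M: "M \<in> parts_in A n"
    then have "0 \<notin># M" using assms by (auto simp: parts_in_def)
    moreover have "sum_list (sorted_list_of_multiset M) = n"
      using M by (metis (mono_tags, lifting) mem_Collect_eq mset_sorted_list_of_multiset
          parts_in_def sum_mset_sum_list)
    ultimately show "rev (sorted_list_of_multiset M) \<in> partitions n"
      using M by (auto simp: partitions_def sorted_wrt_rev sum_list_rev intro: gr0I)
    show "set (rev (sorted_list_of_multiset M)) \<subseteq> A"
      using M by (simp add: parts_in_def)
  qed
qed

lemma finite_parts_in: "0 \<notin> A \<Longrightarrow> finite (parts_in A n)"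
  using bij_betw_finite[OF bij_betw_mset_partitions, of A n] finite_partitions[of n] by simp

lemma p_reg_eq_pcount: "p_reg k n = pcount {d. \<not> k dvd d} n"
  using bij_betw_same_card[OF bij_betw_mset_partitions, of "{d. \<not> k dvd d}" n]
  by (simp add: p_reg_def pcount_def regular_partitions_def subset_eq)

text \<open>\<open>0 dvd x\<close> holds only for \<open>x = 0\<close>, so \<open>k = 0\<close>
  forbids no positive part.\<close>

lemma p_ord_eq_p_reg_0: "p_ord n = p_reg 0 n"
  by (auto simp: p_ord_def p_reg_def regular_partitions_def partitions_def intro!: arg_cong[where f = card])

lemma pcount_0: "0 \<notin> A \<Longrightarrow> pcount A 0 = 1"
proof -
  assume "0 \<notin> A"
  then have "parts_in A 0 = {{#}}"
    by (auto simp: parts_in_def subset_iff) (metis multiset_nonemptyE)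
  then show ?thesis by (simp add: pcount_def)
qed

lemma member_parts_le: "M \<in> parts_in A n \<Longrightarrow> d \<in># M \<Longrightarrow> d \<le> n"
  using sum_mset.remove[of d M] by (auto simp: parts_in_def)

lemma pcount_bounded_parts: "pcount A n = pcount {d \<in> A. d \<le> n} n"
proof -
  have "parts_in A n = parts_in {d \<in> A. d \<le> n} n"
    using member_parts_le by (fastforce simp: parts_in_def)
  then show ?thesis by (simp add: pcount_def)
qed

text \<open>Deleting \<open>j\<close> copies of \<open>d\<close> is a bijection onto the partitions
  of \<open>n - j * d\<close>.\<close>

lemma card_parts_in_count_ge:
  assumes "d \<in> A"
  shows "card {M \<in> parts_in A n. j \<le> count M d} = (if j * d \<le> n then pcount A (n - j * d) else 0)"
proof -
  let ?S = "{M \<in> parts_in A n. j \<le> count M d}"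
  have split: "\<exists>N. M = N + replicate_mset j d" if "j \<le> count M d" for M
    using that by (metis count_le_replicate_mset_subset_eq subset_mset.add_diff_inverse union_commute)
  show ?thesis
  proof (cases "j * d \<le> n")
    case True
    have "bij_betw (\<lambda>N. N + replicate_mset j d) (parts_in A (n - j * d)) ?S"
      unfolding bij_betw_def
    proof
      show "(\<lambda>N. N + replicate_mset j d) ` parts_in A (n - j * d) = ?S"
        using assms True split by (fastforce simp: parts_in_def)
    qed (auto simp: inj_on_def)
    then show ?thesis using True by (simp add: bij_betw_same_card pcount_def)
  next
    case False
    then have "?S = {}" using split by (fastforce simp: parts_in_def)
    then show ?thesis using False by (simp only: card.empty if_False)
  qed
qed

text \<open>Split by whether \<open>d\<close> occurs. For generating functions this is
  multiplication by \<open>1 - q^d\<close>.\<close>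

lemma pcount_remove_part:
  assumes "0 \<notin> A" "d \<in> A"
  shows "pcount A n = pcount (A - {d}) n + (if d \<le> n then pcount A (n - d) else 0)"
proof -
  have "parts_in A n = parts_in (A - {d}) n \<union> {M \<in> parts_in A n. 1 \<le> count M d}"
    by (auto simp: parts_in_def not_in_iff Suc_le_eq)
  moreover have "parts_in (A - {d}) n \<inter> {M \<in> parts_in A n. 1 \<le> count M d} = {}"
    by (auto simp: parts_in_def Suc_le_eq subset_iff)
  ultimately have "pcount A n = pcount (A - {d}) n + card {M \<in> parts_in A n. 1 \<le> count M d}"
    unfolding pcount_def using assms
    by (metis card_Un_disjoint finite_Un finite_parts_in)
  then show ?thesis using assms by (simp only: card_parts_in_count_ge) simp
qed

section \<open>The divisor-sum recurrence\<close>

definition div_sum :: "nat set \<Rightarrow> nat \<Rightarrow> nat" where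
  "div_sum A n = \<Sum>{d \<in> A. d dvd n}"

lemma sum_mset_eq_sum_count:
  fixes M :: "nat multiset"
  assumes "finite S" "set_mset M \<subseteq> S"
  shows "sum_mset M = (\<Sum>d\<in>S. count M d * d)"
  using assms(2)
proof (induction M)
  case (add x M)
  have "(\<Sum>d\<in>S. count (add_mset x M) d * d) = (\<Sum>d\<in>S. count M d * d + (if d = x then d else 0))"
    by (intro sum.cong) auto
  with add assms(1) show ?case by (simp add: sum.distrib)
qed simp

text \<open>Double counting of the sum of all parts of all partitions of \<open>n\<close>. The
  multiplicity of \<open>d\<close> is the number of \<open>j \<ge> 1\<close> with
  \<open>j \<le> count M d\<close>; after exchanging the sums, the terms are collected by
  \<open>l = j * d\<close>.\<close>

lemma pcount_recurrence:
  assumes A: "0 \<notin> A"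
  shows "n * pcount A n = (\<Sum>l = 1..n. div_sum A l * pcount A (n - l))"
proof -
  let ?D = "A \<inter> {1..n}"
  have sum: "(\<Sum>d\<in>?D. \<Sum>j = 1..n. if j \<le> count M d then d else 0) = n"
    if M: "M \<in> parts_in A n" for M
  proof -
    have sub: "set_mset M \<subseteq> ?D"
      using M A member_parts_le[OF M] by (force simp: parts_in_def Suc_le_eq intro: gr0I)
    have n: "(\<Sum>d\<in>?D. count M d * d) = n"
      using M sum_mset_eq_sum_count[OF _ sub] by (simp add: parts_in_def)
    have count_le: "count M d \<le> n" if "d \<in> ?D" for d
    proof -
      have "count M d * d \<le> n"
        using member_le_sum[OF that, of "\<lambda>d. count M d * d"] n by simp
      moreover have "count M d * 1 \<le> count M d * d"
        using that by (intro mult_le_mono2) auto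
      ultimately show ?thesis by linarith
    qed
    have "(\<Sum>j = 1..n. if j \<le> count M d then d else 0) = count M d * d" if "d \<in> ?D" for d
    proof -
      have "{1..n} \<inter> {j. j \<le> count M d} = {1..count M d}"
        using count_le[OF that] by auto
      then show ?thesis by (simp add: sum.If_cases)
    qed
    then show ?thesis using n by simp
  qed
  have "n * pcount A n = (\<Sum>M\<in>parts_in A n. \<Sum>d\<in>?D. \<Sum>j = 1..n. if j \<le> count M d then d else 0)"
    using sum by (simp add: pcount_def mult.commute)
  also have "\<dots> = (\<Sum>d\<in>?D. \<Sum>j = 1..n. \<Sum>M\<in>parts_in A n. if j \<le> count M d then d else 0)"
    by (subst sum.swap, rule sum.cong[OF refl], rule sum.swap)
  also have "\<dots> = (\<Sum>d\<in>?D. \<Sum>j = 1..n. d * card {M \<in> parts_in A n. j \<le> count M d})"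
    using finite_parts_in[OF A]
    by (simp add: sum.If_cases Int_def mult.commute)
  also have "\<dots> = (\<Sum>d\<in>?D. \<Sum>j = 1..n. if j * d \<le> n then d * pcount A (n - j * d) else 0)"
    by (intro sum.cong refl) (simp add: card_parts_in_count_ge)
  also have "\<dots> = (\<Sum>d\<in>?D. \<Sum>l = 1..n. if d dvd l then d * pcount A (n - l) else 0)"
  proof (rule sum.cong[OF refl])
    fix d assume d: "d \<in> ?D"
    have "(\<Sum>j = 1..n. if j * d \<le> n then d * pcount A (n - j * d) else 0) =
        (\<Sum>j\<in>{j \<in> {1..n}. j * d \<le> n}. d * pcount A (n - j * d))"
      by (rule sum.inter_filter[symmetric]) simp
    also have "\<dots> = (\<Sum>l\<in>{l \<in> {1..n}. d dvd l}. d * pcount A (n - l))"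
      using d by (intro sum.reindex_bij_witness[where i = "\<lambda>l. l div d" and j = "\<lambda>j. j * d"])
        (auto simp: div_le_dividend Suc_le_eq intro: le_trans[OF div_le_dividend] dest: dvd_imp_le)
    also have "\<dots> = (\<Sum>l = 1..n. if d dvd l then d * pcount A (n - l) else 0)"
      by (rule sum.inter_filter) simp
    finally show "(\<Sum>j = 1..n. if j * d \<le> n then d * pcount A (n - j * d) else 0) =
        (\<Sum>l = 1..n. if d dvd l then d * pcount A (n - l) else 0)" .
  qed
  also have "\<dots> = (\<Sum>l = 1..n. \<Sum>d\<in>?D. if d dvd l then d * pcount A (n - l) else 0)"
    by (rule sum.swap)
  also have "\<dots> = (\<Sum>l = 1..n. div_sum A l * pcount A (n - l))"
  proof (rule sum.cong[OF refl])
    fix l assume l: "l \<in> {1..n}"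
    have "{d \<in> ?D. d dvd l} = {d \<in> A. d dvd l}"
      using l A by (auto dest: dvd_imp_le simp: Suc_le_eq intro: gr0I)
    moreover have "(\<Sum>d\<in>?D. if d dvd l then d * pcount A (n - l) else 0) =
        (\<Sum>d\<in>{d \<in> ?D. d dvd l}. d * pcount A (n - l))"
      by (rule sum.inter_filter[symmetric]) simp
    ultimately show "(\<Sum>d\<in>?D. if d dvd l then d * pcount A (n - l) else 0) = div_sum A l * pcount A (n - l)"
      by (simp add: div_sum_def sum_distrib_right)
  qed
  finally show ?thesis .
qed

text \<open>A proper divisor of \<open>n\<close> is at most \<open>n / 2\<close>, hence at most
  \<open>b\<close>, so twice the sum is at most \<open>2 * n + b * (b + 1)\<close>.\<close>

lemma div_sum_le:
  assumes A: "0 \<notin> A" and n: "1 \<le> n" "n \<le> 2 * b"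
  shows "2 * div_sum A n \<le> b * b + 5 * b"
proof -
  have "{d \<in> A. d dvd n} \<subseteq> insert n {1..b}"
  proof
    fix d assume "d \<in> {d \<in> A. d dvd n}"
    then obtain c where c: "n = d * c" and d: "d \<noteq> 0" using A by (auto elim: dvdE)
    have "c \<noteq> 0" using c n by auto
    then consider "c = 1" | "2 \<le> c" by linarith
    then show "d \<in> insert n {1..b}"
    proof cases
      case 2
      then have "d * 2 \<le> n" unfolding c by (rule mult_le_mono2)
      then show ?thesis using d n by auto
    qed (use c in auto)
  qed
  then have "div_sum A n \<le> \<Sum>(insert n {1..b})"
    unfolding div_sum_def by (intro sum_mono2) auto
  also have "\<dots> \<le> n + \<Sum>{1..b}"
    by (simp add: sum.insert_if)
  finally have "2 * div_sum A n \<le> 2 * n + 2 * \<Sum>{1..b}" by simp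
  also have "2 * \<Sum>{1..b} = b * (b + 1)"
    using gauss_sum_from_Suc_0[of b, where 'a = nat] by simp
  finally show ?thesis using n by (simp add: algebra_simps)
qed

section \<open>The inductive step\<close>

text \<open>The spare \<open>a * p a * p b\<close> is divided in the ratio \<open>K\<close> to 1:
  the larger share pays for the excess in the terms \<open>l \<le> b\<close>, the smaller for the
  terms \<open>l > b\<close>.\<close>

lemma bessenrodt_ono_step:
  fixes p \<sigma> :: "nat \<Rightarrow> nat"
  assumes rec: "\<And>n. n * p n = (\<Sum>l = 1..n. \<sigma> l * p (n - l))"
    and mono: "\<And>m n. m \<le> n \<Longrightarrow> p m \<le> p n"
    and pa: "0 < p a" and a: "1 \<le> a"
    and big: "\<And>n. 1 \<le> n \<Longrightarrow> n \<le> a + b \<Longrightarrow> (K + 1) * \<sigma> n < p b"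
    and excess: "(\<Sum>m<b. p (a + m) - p a * p m) \<le> K * a * p a"
  shows "p (a + b) < p a * p b"
proof -
  \<comment> \<open>Truncated subtraction makes \<open>e m\<close> vanish wherever the pair
    \<open>(a, m)\<close> causes no excess.\<close>
  define e where "e m = p (a + m) - p a * p m" for m
  let ?X = "\<Sum>l = 1..b. \<sigma> l * e (b - l)"
  let ?Y = "\<Sum>l = b+1..a+b. \<sigma> l * p (a + b - l)"
  have low: "(\<Sum>l = 1..b. \<sigma> l * p (a + b - l)) \<le> p a * (b * p b) + ?X"
  proof -
    have "(\<Sum>l = 1..b. \<sigma> l * p (a + b - l)) \<le> (\<Sum>l = 1..b. p a * (\<sigma> l * p (b - l)) + \<sigma> l * e (b - l))"
    proof (rule sum_mono)
      fix l assume "l \<in> {1..b}"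
      then have "p (a + b - l) \<le> p a * p (b - l) + e (b - l)"
        by (simp add: e_def)
      then have "\<sigma> l * p (a + b - l) \<le> \<sigma> l * (p a * p (b - l) + e (b - l))"
        by (rule mult_le_mono2)
      then show "\<sigma> l * p (a + b - l) \<le> p a * (\<sigma> l * p (b - l)) + \<sigma> l * e (b - l)"
        by (simp add: algebra_simps)
    qed
    then show ?thesis by (simp add: sum.distrib rec[of b] sum_distrib_left)
  qed
  have "(K + 1) * ?X \<le> (\<Sum>l = 1..b. p b * e (b - l))"
    unfolding sum_distrib_left mult.assoc[symmetric]
    using big by (intro sum_mono mult_le_mono1) (auto intro: less_imp_le)
  also have "\<dots> = p b * (\<Sum>m<b. e m)"
    unfolding sum_distrib_left
    by (rule sum.reindex_bij_witness[where i = "\<lambda>m. b - m" and j = "\<lambda>l. b - l"]) auto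
  also have "\<dots> \<le> p b * (K * a * p a)"
    using excess by (simp add: e_def)
  finally have X: "(K + 1) * ?X \<le> p b * (K * a * p a)" .
  have "(K + 1) * ?Y < (\<Sum>l = b+1..a+b. p b * p a)"
    unfolding sum_distrib_left
  proof (rule sum_strict_mono)
    fix l assume l: "l \<in> {b+1..a+b}"
    then have "(K + 1) * \<sigma> l * p (a + b - l) \<le> (K + 1) * \<sigma> l * p a"
      by (intro mult_le_mono2 mono) auto
    also have "\<dots> < p b * p a"
      using big[of l] l pa by simp
    finally show "(K + 1) * (\<sigma> l * p (a + b - l)) < p b * p a" by (simp only: mult.assoc)
  qed (use a in auto)
  then have Y: "(K + 1) * ?Y < a * (p b * p a)" by simp
  have "(a + b) * p (a + b) = (\<Sum>l = 1..b. \<sigma> l * p (a + b - l)) + ?Y"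
    unfolding rec[of "a + b"]
    using sum.ub_add_nat[of 1 b "\<lambda>l. \<sigma> l * p (a + b - l)" a] by (simp add: add.commute)
  then have "(K + 1) * ((a + b) * p (a + b)) \<le> (K + 1) * (p a * (b * p b) + ?X + ?Y)"
    using low by (intro mult_le_mono2) simp
  also have "\<dots> = (K + 1) * (p a * (b * p b)) + (K + 1) * ?X + (K + 1) * ?Y"
    by (simp only: distrib_left)
  also have "\<dots> < (K + 1) * (p a * (b * p b)) + p b * (K * a * p a) + a * (p b * p a)"
    using X Y by linarith
  also have "\<dots> = ((K + 1) * (a + b)) * (p a * p b)"
    by (simp add: algebra_simps)
  finally show ?thesis
    by (metis mult.assoc mult_less_cancel1)
qed

text \<open>
  Pairs \<open>(a, m)\<close> with \<open>m < s\<close> always violate the inequality. Their excess is controlled by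
  \<open>p(a + m) \<le> p(u) p(a + m - u) \<le> 2 p(a)\<close>, which is again an instance of the induction hypothesis.
\<close>

lemma bessenrodt_ono_large:
  fixes p \<sigma> :: "nat \<Rightarrow> nat"
  assumes rec: "\<And>n. n * p n = (\<Sum>l = 1..n. \<sigma> l * p (n - l))"
    and mono: "\<And>m n. m \<le> n \<Longrightarrow> p m \<le> p n" and p0: "p 0 = 1"
    and big: "\<And>n b. B \<le> b \<Longrightarrow> 1 \<le> n \<Longrightarrow> n \<le> 2 * b \<Longrightarrow> (K + 1) * \<sigma> n < p b"
    and small: "\<And>a. s \<le> a \<Longrightarrow> a < B \<Longrightarrow> (\<Sum>m<B. p (a + m) - p a * p m) \<le> K * a * p a"
    and mid: "\<And>a m. B \<le> a \<Longrightarrow> 1 \<le> m \<Longrightarrow> m < s \<Longrightarrow> a + m < B + u \<Longrightarrow> p (a + m) \<le> 2 * p a"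
    and u: "p u = 2" "s \<le> u" "u \<le> B" and s: "1 \<le> s" and K: "1 \<le> K"
  shows "s \<le> a \<Longrightarrow> a \<le> b \<Longrightarrow> B \<le> b \<Longrightarrow> p (a + b) < p a * p b"
proof (induction "a + b" arbitrary: a b rule: less_induct)
  case less
  have pos: "1 \<le> p m" for m using mono[of 0 m] p0 by simp
  have IH: "p (a' + b') < p a' * p b'" if "a' + b' < a + b" "s \<le> a'" "a' \<le> b'" "B \<le> b'" for a' b'
    using less(1) that by blast
  have "(\<Sum>m<b. p (a + m) - p a * p m) \<le> K * a * p a"
  proof (cases "a < B")
    case True
    have "(\<Sum>m<b. p (a + m) - p a * p m) = (\<Sum>m<B. p (a + m) - p a * p m)"
    proof (rule sum.mono_neutral_right)
      show "\<forall>m\<in>{..<b} - {..<B}. p (a + m) - p a * p m = 0"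
        using IH True less.prems by (simp add: less_imp_le)
    qed (use less.prems in auto)
    then show ?thesis using small True less.prems by simp
  next
    case False
    have zero: "p (a + m) - p a * p m = 0" if "s \<le> m" "m < b" for m
    \<comment> \<open>The induction hypothesis wants the larger entry second; in both orders it is
      at least \<open>B\<close>.\<close>
    proof (cases "m \<le> a")
      case True
      then show ?thesis using IH[of m a] that False by (simp add: add.commute mult.commute)
    next
      case mgt: False
      then show ?thesis using IH[of a m] that False less.prems by simp
    qed
    have double: "p (a + m) \<le> 2 * p a" if m: "1 \<le> m" "m < s" for m
    proof (cases "a + m < B + u")
      case True
      then show ?thesis using mid m False by simp
    next
      case ge: False
      \<comment> \<open>Here \<open>a + m - u \<ge> B\<close>, and \<open>a + m < a + b\<close>
        because \<open>m < s \<le> u \<le> B \<le> b\<close>.\<close>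
      then have "p (u + (a + m - u)) < p u * p (a + m - u)"
        using u m less.prems s by (intro IH) auto
      also have "p (a + m - u) \<le> p a" using m u by (intro mono) auto
      finally show ?thesis using ge u by simp
    qed
    have "(\<Sum>m<b. p (a + m) - p a * p m) = (\<Sum>m\<in>{1..<s}. p (a + m) - p a * p m)"
    proof (rule sum.mono_neutral_right)
      show "\<forall>m\<in>{..<b} - {1..<s}. p (a + m) - p a * p m = 0"
      proof
        fix m assume "m \<in> {..<b} - {1..<s}"
        then consider "m = 0" | "s \<le> m" "m < b" by fastforce
        then show "p (a + m) - p a * p m = 0" using zero p0 by cases auto
      qed
    qed (use less.prems u in auto)
    also have "\<dots> \<le> (\<Sum>m\<in>{1..<s}. p a)"
    proof (rule sum_mono)
      fix m assume "m \<in> {1..<s}"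
      then have "p (a + m) \<le> 2 * p a" using double by simp
      moreover have "p a * 1 \<le> p a * p m" using pos by (rule mult_le_mono2)
      ultimately show "p (a + m) - p a * p m \<le> p a" by linarith
    qed
    \<comment> \<open>There are \<open>s - 1\<close> terms, and
      \<open>s - 1 \<le> a\<close>.\<close>
    also have "\<dots> \<le> K * a * p a"
      using mult_le_mono[OF K, of "s - 1" a] less.prems by simp
    finally show ?thesis .
  qed
  then show ?case
    using less.prems big s pos[of a] by (intro bessenrodt_ono_step[OF rec mono]) auto
qed

text \<open>
  In the application \<open>q\<close> and \<open>r\<close> count the partitions avoiding the part \<open>1\<close>, respectively the
  parts \<open>1\<close> and \<open>d\<close>, so that the lower bound for all \<open>n\<close> follows from one window of values each.
\<close>

lemma quadratic_growth:
  fixes p q r :: "nat \<Rightarrow> nat"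
  assumes p: "\<And>n. B < n \<Longrightarrow> p n = q n + p (n - 1)"
    and q: "\<And>n. B + d \<le> n \<Longrightarrow> q n = r n + q (n - d)"
    and r: "\<And>n. B + e \<le> n \<Longrightarrow> r (n - e) \<le> r n"
    and de: "0 < d" "0 < e"
    and p0: "M * (B * B + 5 * B) < 2 * p B"
    and q0: "\<And>n. B \<le> n \<Longrightarrow> n < B + d \<Longrightarrow> M * (n + 2) \<le> q n"
    and r0: "\<And>n. B \<le> n \<Longrightarrow> n < B + e \<Longrightarrow> M * d \<le> r n"
  shows "B \<le> n \<Longrightarrow> M * (n * n + 5 * n) < 2 * p n"
proof -
  have R: "B \<le> n \<Longrightarrow> M * d \<le> r n" for n
  proof (induction n rule: less_induct)
    case (less n)
    show ?case
    proof (cases "n < B + e")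
      case False
      then have "M * d \<le> r (n - e)" using de by (intro less.IH) auto
      then show ?thesis using r[of n] False by simp
    qed (use r0 less in auto)
  qed
  \<comment> \<open>A step of length \<open>d\<close> raises the bound by \<open>M * d\<close>,
    which is what \<open>R\<close> supplies.\<close>
  have Q: "B \<le> n \<Longrightarrow> M * (n + 2) \<le> q n" for n
  proof (induction n rule: less_induct)
    case (less n)
    show ?case
    proof (cases "n < B + d")
      case False
      then have "M * (n - d + 2) \<le> q (n - d)" using de by (intro less.IH) auto
      then have "M * (n - d + 2) + M * d \<le> q n" using R[of n] q[of n] False less.prems by simp
      moreover have "n + 2 = (n - d + 2) + d" using False by simp
      ultimately show ?thesis by (metis distrib_left)
    qed (use q0 less in auto)
  qed
  show "B \<le> n \<Longrightarrow> M * (n * n + 5 * n) < 2 * p n"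
  proof (induction n rule: dec_induct)
    case (step n)
    \<comment> \<open>The first difference of \<open>n * n + 5 * n\<close> is
      \<open>2 * (n + 3)\<close>.\<close>
    have "M * (Suc n * Suc n + 5 * Suc n) = M * (n * n + 5 * n) + 2 * (M * (Suc n + 2))"
      by (simp add: algebra_simps)
    also have "\<dots> < 2 * p (Suc n)"
      using step Q[of "Suc n"] p[of "Suc n"] by simp
    finally show ?case .
  qed (use p0 in auto)
qed

section \<open>Tables and certificates\<close>

text \<open>The first argument is a queue holding the last \<open>d\<close> entries of the result, where \<open>d\<close> is the new part.\<close>

fun add_part :: "nat list \<Rightarrow> nat list \<Rightarrow> nat list" where
  "add_part (p # ps) (x # xs) = (\<lambda>y. y # add_part (ps @ [y]) xs) (x + p)"
| "add_part _ _ = []"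

text \<open>The coefficients of the product of the factors \<open>1 / (1 - q^d)\<close>, built up
  from those of the constant 1.\<close>

definition ptable :: "nat \<Rightarrow> nat \<Rightarrow> nat list" where
  "ptable k N = foldl (\<lambda>xs d. add_part (replicate d 0) xs) (1 # replicate (N - 1) 0)
     (filter (\<lambda>d. \<not> k dvd d) [1..<N])"

text \<open>At position \<open>i\<close> the queue holds \<open>g (i - d), ..., g (i - 1)\<close>,
  with 0 at negative arguments; the start \<open>i\<close> is general because the induction shifts
  it.\<close>

lemma add_part_eq_map:
  fixes f g :: "nat \<Rightarrow> nat"
  assumes d: "0 < d" and g: "\<And>n. g n = f n + (if d \<le> n then g (n - d) else 0)"
  shows "add_part (map (\<lambda>j. if d \<le> j then g (j - d) else 0) [i..<i + d]) (map f [i..<i + n]) = map g [i..<i + n]"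
proof (induction n arbitrary: i)
  case (Suc n)
  let ?h = "\<lambda>j. if d \<le> j then g (j - d) else 0"
  have "map ?h [i..<i + d] = ?h i # map ?h [Suc i..<i + d]"
    using d by (simp add: upt_conv_Cons)
  moreover have "map ?h [Suc i..<i + d] @ [g i] = map ?h [Suc i..<Suc i + d]"
    using d by simp
  moreover have "[i..<i + Suc n] = i # [Suc i..<Suc i + n]"
    by (simp add: upt_conv_Cons del: upt_Suc)
  moreover have "f i + ?h i = g i"
    using g[of i] by simp
  ultimately show ?case
    using Suc.IH[of "Suc i"] by (simp del: upt_Suc)
qed simp

lemma pcount_empty: "pcount {} n = (if n = 0 then 1 else 0)"
proof -
  have "parts_in {} n = (if n = 0 then {{#}} else {})"
    by (auto simp: parts_in_def)
  then show ?thesis by (simp add: pcount_def)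
qed

lemma foldl_add_part:
  assumes "distinct ds" "0 \<notin> set ds" "0 \<notin> A" "A \<inter> set ds = {}"
  shows "foldl (\<lambda>xs d. add_part (replicate d 0) xs) (map (pcount A) [0..<N]) ds =
    map (pcount (A \<union> set ds)) [0..<N]"
  using assms
proof (induction ds arbitrary: A)
  case (Cons d ds)
  have "pcount (insert d A) n = pcount A n + (if d \<le> n then pcount (insert d A) (n - d) else 0)" for n
    using pcount_remove_part[of "insert d A" d n] Cons.prems by simp
  moreover have "map (\<lambda>j. if d \<le> j then pcount (insert d A) (j - d) else 0) [0..<0 + d] = replicate d 0"
    by (rule nth_equalityI) auto
  ultimately have "add_part (replicate d 0) (map (pcount A) [0..<N]) = map (pcount (insert d A)) [0..<N]"
    using add_part_eq_map[of d "pcount (insert d A)" "pcount A" 0 N] Cons.prems by simp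
  then show ?case using Cons by simp
qed simp

lemma ptable_eq_map:
  assumes "0 < N"
  shows "ptable k N = map (p_reg k) [0..<N]"
proof -
  have "1 # replicate (N - 1) 0 = map (pcount {}) [0..<N]"
    using assms by (intro nth_equalityI) (auto simp: pcount_empty nth_Cons')
  moreover have "set (filter (\<lambda>d. \<not> k dvd d) [1..<N]) = {d. \<not> k dvd d \<and> 1 \<le> d \<and> d < N}"
    by auto
  ultimately have "ptable k N = map (pcount {d. \<not> k dvd d \<and> 1 \<le> d \<and> d < N}) [0..<N]"
    unfolding ptable_def using foldl_add_part[of "filter (\<lambda>d. \<not> k dvd d) [1..<N]" "{}" N] by simp
  also have "\<dots> = map (p_reg k) [0..<N]"
  proof (rule map_cong[OF refl])
    fix n assume "n \<in> set [0..<N]"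
    then have "{d \<in> {d. \<not> k dvd d \<and> 1 \<le> d \<and> d < N}. d \<le> n} = {d \<in> {d. \<not> k dvd d}. d \<le> n}"
      by (auto intro: Suc_leI gr0I)
    then show "pcount {d. \<not> k dvd d \<and> 1 \<le> d \<and> d < N} n = p_reg k n"
      using pcount_bounded_parts[of "{d. \<not> k dvd d \<and> 1 \<le> d \<and> d < N}" n]
        pcount_bounded_parts[of "{d. \<not> k dvd d}" n]
      by (simp only: p_reg_eq_pcount)
  qed
  finally show ?thesis .
qed

definition row :: "nat list \<Rightarrow> nat \<Rightarrow> nat \<Rightarrow> (nat \<times> nat) list" where
  "row t B a = take B (zip t (drop a t))"

lemma row_eq:
  assumes "a \<le> B"
  shows "row (map p [0..<2 * B]) B a = map (\<lambda>m. (p m, p (a + m))) [0..<B]"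
  using assms by (intro nth_equalityI) (auto simp: row_def)

text \<open>Keeping ties and also \<open>m < a\<close> lets one list serve the equalities, the
  failures and the total excess.\<close>

definition overflow :: "nat \<Rightarrow> nat list \<Rightarrow> nat \<Rightarrow> (nat \<times> nat \<times> nat) list" where
  "overflow B t a = (\<lambda>pa. filter (\<lambda>(m, x, y). x \<le> y)
     (map (\<lambda>(m, x, y). (m, pa * x, y)) (zip [0..<B] (row t B a)))) (t ! a)"

lemma overflow_eq:
  assumes "a < B"
  shows "overflow B (map p [0..<2 * B]) a =
    map (\<lambda>m. (m, p a * p m, p (a + m))) (filter (\<lambda>m. p a * p m \<le> p (a + m)) [0..<B])"
  using assms by (simp add: overflow_def row_eq zip_map2 zip_same_conv_map filter_map comp_def)

definition excess :: "(nat \<times> nat \<times> nat) list \<Rightarrow> nat" where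
  "excess L = sum_list (map (\<lambda>(m, x, y). y - x) L)"

lemma excess_overflow:
  assumes "a < B"
  shows "excess (overflow B (map p [0..<2 * B]) a) = (\<Sum>m<B. p (a + m) - p a * p m)"
proof -
  have "excess (overflow B (map p [0..<2 * B]) a) =
      (\<Sum>m\<leftarrow>[0..<B]. if p a * p m \<le> p (a + m) then p (a + m) - p a * p m else 0)"
    using assms by (simp add: overflow_eq excess_def comp_def sum_list_map_filter')
  also have "\<dots> = (\<Sum>m<B. if p a * p m \<le> p (a + m) then p (a + m) - p a * p m else 0)"
    by (simp only: interv_sum_list_conv_sum_set_nat set_upt atLeast0LessThan)
  also have "\<dots> = (\<Sum>m<B. p (a + m) - p a * p m)"
    by (rule sum.cong) auto
  finally show ?thesis .
qed

text \<open>
  The finite checks behind the bound \<open>B\<close>: the total excess for \<open>a < B\<close>, the doubling bound just above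
  \<open>B\<close>, and the initial windows of \<open>quadratic_growth\<close>, with \<open>q\<close> and \<open>r\<close> written as first and second
  differences of the table \<open>t\<close> and rearranged to avoid truncated subtraction.
\<close>

definition certificate ::
  "nat \<Rightarrow> nat \<Rightarrow> nat \<Rightarrow> nat \<Rightarrow> nat \<Rightarrow> nat \<Rightarrow> nat list \<Rightarrow> (nat \<times> (nat \<times> nat \<times> nat) list) list \<Rightarrow> bool" where
  "certificate s u K B d e t Ls \<longleftrightarrow>
     1 \<le> s \<and> s \<le> u \<and> u \<le> B \<and> 1 \<le> K \<and> 1 < d \<and> d < e \<and> e < B \<and> t ! u = 2 \<and>
     list_all (\<lambda>(a, L). excess L \<le> K * a * t ! a) Ls \<and>
     list_all (\<lambda>a. list_all (\<lambda>m. a + m < B + u \<longrightarrow> t ! (a + m) \<le> 2 * t ! a) [1..<s]) [B..<B + u] \<and>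
     (K + 1) * (B * B + 5 * B) < 2 * t ! B \<and>
     list_all (\<lambda>n. (K + 1) * (n + 2) + t ! (n - 1) \<le> t ! n) [B..<B + d] \<and>
     list_all (\<lambda>n. (K + 1) * d + t ! (n - 1) + t ! (n - d) \<le> t ! n + t ! (n - d - 1)) [B..<B + e]"

definition hits ::
  "(nat \<Rightarrow> nat \<Rightarrow> bool) \<Rightarrow> (nat \<times> (nat \<times> nat \<times> nat) list) list \<Rightarrow> (nat \<times> nat) list" where
  "hits R Ls = concat (map (\<lambda>(a, L). map (\<lambda>(m, x, y). (a, m)) (filter (\<lambda>(m, x, y). a \<le> m \<and> R x y) L)) Ls)"

definition profile ::
  "nat \<Rightarrow> nat \<Rightarrow> nat \<Rightarrow> nat \<Rightarrow> nat \<Rightarrow> nat \<Rightarrow> nat list \<Rightarrow> bool \<times> (nat \<times> nat) list \<times> (nat \<times> nat) list" where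
  "profile s u K B d e t = (\<lambda>Ls. (certificate s u K B d e t Ls, hits (=) Ls, hits (<) Ls))
     (map (\<lambda>a. (a, overflow B t a)) [s..<B])"

lemma set_hits:
  assumes "\<And>x y. R x y \<Longrightarrow> x \<le> y"
  shows "set (hits R (map (\<lambda>a. (a, overflow B (map p [0..<2 * B]) a)) [s..<B])) =
    {(a, b). s \<le> a \<and> a \<le> b \<and> b < B \<and> R (p a * p b) (p (a + b))}"
  using assms by (fastforce simp: hits_def overflow_eq filter_map comp_def)

section \<open>From a certificate to the inequality for large \<open>b\<close>\<close>

lemma p_reg_recurrence:
  "n * p_reg k n = (\<Sum>l = 1..n. div_sum {d. \<not> k dvd d} l * p_reg k (n - l))"
  by (simp add: p_reg_eq_pcount pcount_recurrence)

lemma p_reg_remove_1: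
  "k \<noteq> 1 \<Longrightarrow> p_reg k (Suc n) = pcount ({d. \<not> k dvd d} - {1}) (Suc n) + p_reg k n"
  by (simp add: p_reg_eq_pcount pcount_remove_part[of "{d. \<not> k dvd d}" 1 "Suc n"])

lemma p_reg_mono: "k \<noteq> 1 \<Longrightarrow> m \<le> n \<Longrightarrow> p_reg k m \<le> p_reg k n"
  by (rule lift_Suc_mono_le) (simp_all add: p_reg_remove_1)

text \<open>The windows yield quadratic growth of \<open>p_reg k\<close>, which together with
  \<open>div_sum_le\<close> gives the size condition \<open>big\<close> of
  \<open>bessenrodt_ono_large\<close>.\<close>

lemma certificate_imp_bessenrodt_ono:
  assumes cert: "certificate s u K B d e t Ls"
    and t_def: "t = map (p_reg k) [0..<2 * B]"
    and Ls_def: "Ls = map (\<lambda>a. (a, overflow B t a)) [s..<B]"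
    and k: "k \<noteq> 1" "\<not> k dvd d" "\<not> k dvd e"
    and ab: "s \<le> a" "a \<le> b" "B \<le> b"
  shows "p_reg k (a + b) < p_reg k a * p_reg k b"
proof -
  let ?A = "{d. \<not> k dvd d}" and ?p = "p_reg k"
  define q where "q = pcount (?A - {1})"
  define r where "r = pcount (?A - {1} - {d})"
  have side: "1 \<le> s" "s \<le> u" "u \<le> B" "1 \<le> K" "1 < d" "d < e" "e < B" and pu: "t ! u = 2"
    and ex: "\<And>a. s \<le> a \<Longrightarrow> a < B \<Longrightarrow> excess (overflow B t a) \<le> K * a * t ! a"
    and mid: "\<And>a m. B \<le> a \<Longrightarrow> a < B + u \<Longrightarrow> 1 \<le> m \<Longrightarrow> m < s \<Longrightarrow> a + m < B + u \<Longrightarrow>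
      t ! (a + m) \<le> 2 * t ! a"
    and p0: "(K + 1) * (B * B + 5 * B) < 2 * t ! B"
    and q0: "\<And>n. B \<le> n \<Longrightarrow> n < B + d \<Longrightarrow> (K + 1) * (n + 2) + t ! (n - 1) \<le> t ! n"
    and r0: "\<And>n. B \<le> n \<Longrightarrow> n < B + e \<Longrightarrow>
      (K + 1) * d + t ! (n - 1) + t ! (n - d) \<le> t ! n + t ! (n - d - 1)"
    using cert unfolding certificate_def list_all_iff Ls_def by auto
  have t: "t ! n = ?p n" if "n < 2 * B" for n using that by (simp add: t_def)
  have p_rec: "?p n = q n + ?p (n - 1)" if "0 < n" for n
    using p_reg_remove_1[OF k(1), of "n - 1"] that by (simp add: q_def)
  have q_rec: "q n = r n + q (n - d)" if "d \<le> n" for n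
    using pcount_remove_part[of "?A - {1}" d n] k side that by (simp add: q_def r_def)
  \<comment> \<open>The difference counts the partitions of \<open>n\<close> that avoid
    \<open>e\<close> as well, so it is nonnegative.\<close>
  have r_rec: "r (n - e) \<le> r n" if "e \<le> n" for n
    using pcount_remove_part[of "?A - {1} - {d}" e n] k side that by (simp add: r_def)
  have growth: "(K + 1) * (n * n + 5 * n) < 2 * ?p n" if "B \<le> n" for n
  proof (rule quadratic_growth[where B = B and d = d and e = e and q = q and r = r])
    show "(K + 1) * (n + 2) \<le> q n" if "B \<le> n" "n < B + d" for n
      using q0[of n] that side t[of n] t[of "n - 1"] p_rec[of n] by simp
    show "(K + 1) * d \<le> r n" if "B \<le> n" "n < B + e" for n
    proof -
      have "n < 2 * B" "0 < n" "0 < n - d" "d \<le> n" using that side by auto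
      then have "?p n = q n + ?p (n - 1)" "?p (n - d) = q (n - d) + ?p (n - d - 1)" "q n = r n + q (n - d)"
        using p_rec q_rec by blast+
      moreover have "t ! n = ?p n" "t ! (n - 1) = ?p (n - 1)" "t ! (n - d) = ?p (n - d)"
        "t ! (n - d - 1) = ?p (n - d - 1)"
        using \<open>n < 2 * B\<close> by (auto intro!: t)
      ultimately show ?thesis using r0[OF that] by linarith
    qed
    show "?p n = q n + ?p (n - 1)" if "B < n" for n using that by (intro p_rec) simp
    show "q n = r n + q (n - d)" if "B + d \<le> n" for n using that by (intro q_rec) simp
    show "r (n - e) \<le> r n" if "B + e \<le> n" for n using that by (intro r_rec) simp
    show "(K + 1) * (B * B + 5 * B) < 2 * ?p B" using p0 t[of B] side by simp
  qed (use side that in auto)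
  show ?thesis
  proof (rule bessenrodt_ono_large[where B = B and K = K and s = s and u = u])
    show "n * ?p n = (\<Sum>l = 1..n. div_sum ?A l * ?p (n - l))" for n
      by (rule p_reg_recurrence)
    show "(K + 1) * div_sum ?A n < ?p b" if "B \<le> b" "1 \<le> n" "n \<le> 2 * b" for n b
    proof -
      have "2 * ((K + 1) * div_sum ?A n) = (K + 1) * (2 * div_sum ?A n)" by simp
      also have "\<dots> \<le> (K + 1) * (b * b + 5 * b)"
        using that by (intro mult_le_mono2 div_sum_le) auto
      also have "\<dots> < 2 * ?p b" using growth that by simp
      finally show ?thesis by simp
    qed
    show "(\<Sum>m<B. ?p (a + m) - ?p a * ?p m) \<le> K * a * ?p a" if "s \<le> a" "a < B" for a
      using ex[OF that] excess_overflow[of a B ?p] t[of a] that by (simp add: t_def)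
    show "?p (a + m) \<le> 2 * ?p a" if "B \<le> a" "1 \<le> m" "m < s" "a + m < B + u" for a m
      using mid[of a m] t[of a] t[of "a + m"] that side by simp
    show "?p u = 2" using pu t[of u] side by simp
  qed (use side ab k p_reg_mono p_reg_0 in auto)
qed

text \<open>The certificate forces \<open>b < B\<close> for every exceptional pair, and below
  \<open>B\<close> the lists are exhaustive.\<close>

lemma exceptions_of_profile:
  assumes prof: "profile s u K B d e (map (p_reg k) [0..<2 * B]) = (True, E, F)"
    and k: "k \<noteq> 1" "\<not> k dvd d" "\<not> k dvd e" and s: "2 \<le> s"
  shows "{(a, b) \<in> equality_pairs (p_reg k). s \<le> a} = set E"
    and "{(a, b) \<in> failure_pairs (p_reg k). s \<le> a} = set F"
proof -
  define t where "t = map (p_reg k) [0..<2 * B]"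
  define Ls where "Ls = map (\<lambda>a. (a, overflow B t a)) [s..<B]"
  have cert: "certificate s u K B d e t Ls" and EF: "E = hits (=) Ls" "F = hits (<) Ls"
    using prof by (auto simp: profile_def t_def Ls_def)
  have "b < B" if "s \<le> a" "a \<le> b" "p_reg k a * p_reg k b \<le> p_reg k (a + b)" for a b
    using certificate_imp_bessenrodt_ono[OF cert t_def Ls_def k that(1,2)] that(3)
    by (meson leD leI)
  then show "{(a, b) \<in> equality_pairs (p_reg k). s \<le> a} = set E"
    and "{(a, b) \<in> failure_pairs (p_reg k). s \<le> a} = set F"
    unfolding EF Ls_def t_def
    using s by (subst set_hits; force simp: equality_pairs_def failure_pairs_def)+
qed

section \<open>The exceptional pairs\<close>

text \<open>The check reads only values below \<open>2 * B\<close>, so the table may come from any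
  \<open>k'\<close> that agrees with \<open>k\<close> there; beyond the table it matters only that
  1, \<open>d\<close> and \<open>e\<close> are admissible parts for \<open>k\<close>.\<close>

lemma exceptional_pairs:
  assumes prof: "profile s u K B d e (ptable k' (2 * B)) = (True, E, F)"
    and eq: "\<And>n. n < 2 * B \<Longrightarrow> p_reg k n = p_reg k' n"
    and k: "k \<noteq> 1" "\<not> k dvd d" "\<not> k dvd e" and s: "2 \<le> s" and B: "0 < B"
  shows "{(a, b) \<in> equality_pairs (p_reg k). s \<le> a} = set E"
    and "{(a, b) \<in> failure_pairs (p_reg k). s \<le> a} = set F"
proof -
  have "ptable k' (2 * B) = map (p_reg k) [0..<2 * B]"
    using eq B by (simp add: ptable_eq_map)
  then show "{(a, b) \<in> equality_pairs (p_reg k). s \<le> a} = set E"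
    and "{(a, b) \<in> failure_pairs (p_reg k). s \<le> a} = set F"
    using exceptions_of_profile prof k s by simp_all
qed

lemma exceptional_pairs_2:
  assumes "profile 2 u K B d e (ptable k' (2 * B)) = (True, E, F)"
    and "\<And>n. n < 2 * B \<Longrightarrow> p_reg k n = p_reg k' n"
    and "k \<noteq> 1" "\<not> k dvd d" "\<not> k dvd e" and "0 < B"
  shows "E_reg k = set E" "F_reg k = set F"
proof -
  have "{(a, b) \<in> equality_pairs (p_reg k). 2 \<le> a} = E_reg k"
    "{(a, b) \<in> failure_pairs (p_reg k). 2 \<le> a} = F_reg k"
    by (auto simp: E_reg_def F_reg_def equality_pairs_def failure_pairs_def)
  then show "E_reg k = set E" "F_reg k = set F"
    using exceptional_pairs[OF assms(1-5) _ assms(6)] by simp_all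
qed

lemma p_reg_eq_p_reg_0:
  assumes "n < k"
  shows "p_reg k n = p_reg 0 n"
proof -
  have "{d \<in> {d. \<not> k dvd d}. d \<le> n} = {d \<in> {d. \<not> 0 dvd d}. d \<le> n}"
    using assms by (auto dest: dvd_imp_le intro: gr0I)
  then show ?thesis
    using pcount_bounded_parts[of "{d. \<not> k dvd d}" n] pcount_bounded_parts[of "{d. \<not> 0 dvd d}" n]
    by (simp only: p_reg_eq_pcount)
qed

text \<open>One of \<open>b + 1\<close> and \<open>b + 2\<close> is odd and at least 3. As a single
  part it is a partition without the part 1, so one of the two steps is strict.\<close>

lemma p_reg_2_less:
  assumes "2 \<le> b"
  shows "p_reg 2 b < p_reg 2 (b + 2)"
proof -
  let ?A = "{d. \<not> 2 dvd d} - {1::nat}"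
  have pos: "0 < pcount ?A n" if "n \<in> ?A" for n
    using pcount_remove_part[of ?A n n] pcount_0[of ?A] that by simp
  have "0 < pcount ?A (b + 1) \<or> 0 < pcount ?A (b + 2)"
    using pos[of "b + 1"] pos[of "b + 2"] assms by (cases "even b") auto
  then show ?thesis
    using p_reg_remove_1[of 2 b] p_reg_remove_1[of 2 "b + 1"] by auto
qed

text \<open>For \<open>k = 2\<close> the pairs with \<open>a = 2\<close> always fail since \<open>p_2(2) = 1\<close>, hence \<open>s = 3\<close>.\<close>

lemma profile_2: "profile 3 4 4 60 3 5 (ptable 2 120) = (True,
    [(3,3),(3,5),(3,6),(3,7),(3,8),(4,15),(4,16),(4,17),(5,6),(5,7),(5,8)],
    [(3,4),(4,4),(4,5),(4,6),(4,7),(4,8),(4,9),(4,10),(4,11),(4,12),(4,13),(4,14),(5,5)])"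
  by code_simp

text \<open>As 3 is forbidden, the smallest admissible parts above 1 are \<open>d = 2\<close> and
  \<open>e = 4\<close>.\<close>

lemma profile_3: "profile 2 2 5 40 2 4 (ptable 3 80) = (True, [(2,2),(3,10)],
    [(2,3),(3,3),(3,4),(3,5),(3,6),(3,7),(3,8),(3,9),(3,11),(3,13)])"
  by code_simp

lemma profile_4: "profile 2 2 1 24 2 3 (ptable 4 48) =
    (True, [(2,2),(2,3),(2,5),(3,3),(3,4),(4,4)], [(2,4)])"
  by code_simp

lemma profile_5: "profile 2 2 1 24 2 3 (ptable 5 48) =
    (True, [(2,3),(2,4)], [(2,2),(2,5),(3,3),(3,5)])"
  by code_simp

lemma profile_6: "profile 2 2 2 24 2 3 (ptable 6 48) =
    (True, [(2,4),(2,5),(2,6)], [(2,2),(2,3),(3,3)])"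
  by code_simp

lemma profile_7: "profile 2 2 2 24 2 3 (ptable 7 48) =
    (True, [(2,5),(2,7),(3,5)], [(2,2),(2,3),(2,4),(3,3)])"
  by code_simp

lemma profile_8: "profile 2 2 2 24 2 3 (ptable 8 48) =
    (True, [(3,4),(3,5)], [(2,2),(2,3),(2,4),(2,5),(3,3)])"
  by code_simp

lemma profile_9: "profile 2 2 2 24 2 3 (ptable 9 48) =
    (True, [(2,6),(3,4)], [(2,2),(2,3),(2,4),(2,5),(3,3),(3,5)])"
  by code_simp

text \<open>A constant instead of an abstraction, since the simplifier would rewrite its body for symbolic \<open>k\<close>.\<close>

definition generic_profile :: "nat \<Rightarrow> bool" where
  "generic_profile k \<longleftrightarrow> profile 2 2 2 22 2 3 (ptable k 44) =
     (True, [(2,6),(2,7),(3,4)], [(2,2),(2,3),(2,4),(2,5),(3,3),(3,5)])"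

text \<open>The entry 0 stands for the ordinary partition function and for all
  \<open>k \<ge> 44\<close>.\<close>

lemma profile_ge_10: "list_all generic_profile (0 # [10..<44])"
  by code_simp

lemma E_F_reg_ge_10:
  assumes "k = 0 \<or> 10 \<le> k"
  shows "E_reg k = {(2,6),(2,7),(3,4)}" "F_reg k = {(2,2),(2,3),(2,4),(2,5),(3,3),(3,5)}"
proof -
  define k' where "k' = (if k < 44 then k else 0)"
  have "k' \<in> set (0 # [10..<44])" unfolding k'_def list.set set_upt using assms by auto
  then have "profile 2 2 2 22 2 3 (ptable k' 44) =
      (True, [(2,6),(2,7),(3,4)], [(2,2),(2,3),(2,4),(2,5),(3,3),(3,5)])"
    using profile_ge_10 unfolding list_all_iff generic_profile_def by blast
  moreover have "p_reg k n = p_reg k' n" if "n < 2 * 22" for n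
    using that p_reg_eq_p_reg_0[of n k] by (simp add: k'_def)
  moreover have "\<not> k dvd 2" "\<not> k dvd 3" "k \<noteq> 1"
    using assms by (cases "k = 0"; auto dest!: dvd_imp_le)+
  ultimately show "E_reg k = {(2,6),(2,7),(3,4)}" "F_reg k = {(2,2),(2,3),(2,4),(2,5),(3,3),(3,5)}"
    using exceptional_pairs_2[of 2 2 22 2 3 k' _ _ k] by simp_all
qed

text \<open>Pairs with \<open>a = 2\<close> fail by \<open>p_reg_2_less\<close>; the profile with
  \<open>s = 3\<close> settles the rest.\<close>

lemma E_F_reg_2:
  "E_reg 2 = {(3,3),(3,5),(3,6),(3,7),(3,8),(4,15),(4,16),(4,17),(5,6),(5,7),(5,8)}"
  "F_reg 2 = {(2, b) | b. b \<ge> 2} \<union>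
    {(3,4),(4,4),(4,5),(4,6),(4,7),(4,8),(4,9),(4,10),(4,11),(4,12),(4,13),(4,14),(5,5)}"
proof -
  let ?E = "equality_pairs (p_reg 2)" and ?F = "failure_pairs (p_reg 2)"
  have "map (p_reg 2) [0..<3] = [1, 1, 1]"
    unfolding ptable_eq_map[symmetric, OF zero_less_numeral] by code_simp
  then have "p_reg 2 2 = 1" by (simp add: upt_rec numeral_2_eq_2)
  then have fail: "p_reg 2 2 * p_reg 2 b < p_reg 2 (2 + b)" if "2 \<le> b" for b
    using p_reg_2_less[OF that] by (simp add: add.commute)
  have "(a, b) \<in> ?E \<longleftrightarrow> (a, b) \<in> ?E \<and> 3 \<le> a"
    and "(a, b) \<in> ?F \<longleftrightarrow> a = 2 \<and> 2 \<le> b \<or> (a, b) \<in> ?F \<and> 3 \<le> a" for a b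
  proof -
    consider "a < 2" | "a = 2" | "3 \<le> a" by linarith
    then have "((a, b) \<in> ?E \<longleftrightarrow> (a, b) \<in> ?E \<and> 3 \<le> a) \<and>
      ((a, b) \<in> ?F \<longleftrightarrow> a = 2 \<and> 2 \<le> b \<or> (a, b) \<in> ?F \<and> 3 \<le> a)"
      using fail[of b] by cases (auto simp: equality_pairs_def failure_pairs_def)
    then show "(a, b) \<in> ?E \<longleftrightarrow> (a, b) \<in> ?E \<and> 3 \<le> a"
      and "(a, b) \<in> ?F \<longleftrightarrow> a = 2 \<and> 2 \<le> b \<or> (a, b) \<in> ?F \<and> 3 \<le> a" by blast+
  qed
  then have "?E = {(a, b) \<in> ?E. 3 \<le> a}" "?F = {(2, b) | b. b \<ge> 2} \<union> {(a, b) \<in> ?F. 3 \<le> a}"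
    by blast+
  moreover have "{(a, b) \<in> ?E. 3 \<le> a} = {(3,3),(3,5),(3,6),(3,7),(3,8),(4,15),(4,16),(4,17),(5,6),(5,7),(5,8)}"
    "{(a, b) \<in> ?F. 3 \<le> a} =
      {(3,4),(4,4),(4,5),(4,6),(4,7),(4,8),(4,9),(4,10),(4,11),(4,12),(4,13),(4,14),(5,5)}"
    using exceptional_pairs[of 3 4 4 60 3 5 2 _ _ 2] profile_2 by simp_all
  ultimately show "E_reg 2 = {(3,3),(3,5),(3,6),(3,7),(3,8),(4,15),(4,16),(4,17),(5,6),(5,7),(5,8)}"
    "F_reg 2 = {(2, b) | b. b \<ge> 2} \<union>
      {(3,4),(4,4),(4,5),(4,6),(4,7),(4,8),(4,9),(4,10),(4,11),(4,12),(4,13),(4,14),(5,5)}"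
    unfolding E_reg_def F_reg_def by metis+
qed

theorem theorem3:
  fixes k :: nat
  assumes "k \<ge> 2"
  shows
    "(\<forall>a b. 2 \<le> a \<and> a \<le> b \<longrightarrow>
        (p_reg k a * p_reg k b > p_reg k (a + b) \<longleftrightarrow> (a, b) \<notin> E_reg k \<union> F_reg k)) \<and>
     (k = 2 \<longrightarrow>
        E_reg k = {(3,3),(3,5),(3,6),(3,7),(3,8),(4,15),(4,16),(4,17),(5,6),(5,7),(5,8)} \<and>
        F_reg k = {(2,b) | b. b \<ge> 2} \<union>
          {(3,4),(4,4),(4,5),(4,6),(4,7),(4,8),(4,9),(4,10),(4,11),(4,12),(4,13),(4,14),(5,5)}) \<and>
     (k = 3 \<longrightarrow>
        E_reg k = {(2,2),(3,10)} \<and>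
        F_reg k = {(2,3),(3,3),(3,4),(3,5),(3,6),(3,7),(3,8),(3,9),(3,11),(3,13)}) \<and>
     (k = 4 \<longrightarrow>
        E_reg k = {(2,2),(2,3),(2,5),(3,3),(3,4),(4,4)} \<and>
        F_reg k = {(2,4)}) \<and>
     (k = 5 \<longrightarrow>
        E_reg k = {(2,3),(2,4)} \<and>
        F_reg k = {(2,2),(2,5),(3,3),(3,5)}) \<and>
     (k = 6 \<longrightarrow>
        E_reg k = {(2,4),(2,5),(2,6)} \<and>
        F_reg k = {(2,2),(2,3),(3,3)}) \<and>
     (k = 7 \<longrightarrow>
        E_reg k = {(2,5),(2,7),(3,5)} \<and>
        F_reg k = {(2,2),(2,3),(2,4),(3,3)}) \<and>
     (k = 8 \<longrightarrow>
        E_reg k = {(3,4),(3,5)} \<and>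
        F_reg k = {(2,2),(2,3),(2,4),(2,5),(3,3)}) \<and>
     (k = 9 \<longrightarrow>
        E_reg k = {(2,6),(3,4)} \<and>
        F_reg k = {(2,2),(2,3),(2,4),(2,5),(3,3),(3,5)}) \<and>
     (k \<ge> 10 \<longrightarrow>
        E_reg k = {(2,6),(2,7),(3,4)} \<and>
        F_reg k = {(2,2),(2,3),(2,4),(2,5),(3,3),(3,5)} \<and>
        E_reg k = E_inf \<and> F_reg k = F_inf)"
proof (intro conjI impI allI)
  fix a b :: nat
  assume "2 \<le> a \<and> a \<le> b"
  then show "p_reg k a * p_reg k b > p_reg k (a + b) \<longleftrightarrow> (a, b) \<notin> E_reg k \<union> F_reg k"
    by (auto simp: E_reg_def F_reg_def equality_pairs_def failure_pairs_def)
next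
  \<comment> \<open>The ordinary exception sets are the case \<open>k = 0\<close>, which
    \<open>E_F_reg_ge_10\<close> covers too.\<close>
  have "E_reg 0 = E_inf" "F_reg 0 = F_inf"
    by (simp_all add: E_reg_def F_reg_def E_inf_def F_inf_def p_ord_eq_p_reg_0[abs_def])
  then show "E_reg k = E_inf" "F_reg k = F_inf" if "10 \<le> k"
    using E_F_reg_ge_10[of 0] E_F_reg_ge_10[of k] that by simp_all
qed (use E_F_reg_2 E_F_reg_ge_10[of k]
  exceptional_pairs_2[of 2 5 40 2 4 3 _ _ 3] profile_3
  exceptional_pairs_2[of 2 1 24 2 3 4 _ _ 4] profile_4
  exceptional_pairs_2[of 2 1 24 2 3 5 _ _ 5] profile_5
  exceptional_pairs_2[of 2 2 24 2 3 6 _ _ 6] profile_6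
  exceptional_pairs_2[of 2 2 24 2 3 7 _ _ 7] profile_7
  exceptional_pairs_2[of 2 2 24 2 3 8 _ _ 8] profile_8
  exceptional_pairs_2[of 2 2 24 2 3 9 _ _ 9] profile_9
  in simp_all)

end
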